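(* Let $\Omega$ be a convex set in some (real) linear space, let $n$ be a positive integer, and let $\mathcal{F}:\Omega\to\mathbf{H}^n$ be a function. Then the following two statements are equivalent: (i) For any monotone, convex symmetric form $\phi$ on $\mathbb{R}^n$, the map $X\mapsto\phi\big(\mathcal{F}(X)\big)$ is convex on $\Omega$. (ii) For any $1\le k\le n$, the map $X\mapsto\sum_{i=1}^k\lambda_i^{\downarrow}\big(\mathcal{F}(X)\big)$ is convex on $\Omega$. Similarly, the following two statements are equivalent: (i* ) For any monotone, concave symmetric form $\phi$ on $\mathbb{R}^n$, the map $X\mapsto\phi\big(\mathcal{F}(X)\big)$ is concave on $\Omega$. (ii* ) For any $1\le k\le n$, the map $X\mapsto\sum_{i=1}^k\lambda_i^{\uparrow}\big(\mathcal{F}(X)\big)$ is concave on $\Omega$.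
   Context: $\mathbf{H}^n$ is the space of $n\times n$ complex Hermitian matrices. For $A\in\mathbf{H}^n$, $\boldsymbol{\lambda}(A)\in\mathbb{R}^n$ is the vector of its eigenvalues counted with multiplicity, $\lambda_i^{\downarrow}(A)$ is the $i$-th largest eigenvalue and $\lambda_i^{\uparrow}(A)$ is the $i$-th smallest eigenvalue of $A$. A function $\phi:\mathbb{R}^n\to\mathbb{R}$ is a symmetric form if $\phi(P\boldsymbol{x})=\phi(\boldsymbol{x})$ for every $\boldsymbol{x}\in\mathbb{R}^n$ and every permutation $P\in S_n$ of the entries. It is monotone if $\boldsymbol{x}\ge\boldsymbol{y}$ (entrywise) implies $\phi(\boldsymbol{x})\ge\phi(\boldsymbol{y})$. It is convex if $\phi(\tau\boldsymbol{x}+(1-\tau)\boldsymbol{y})\le\tau\phi(\boldsymbol{x})+(1-\tau)\phi(\boldsymbol{y})$ for all $\boldsymbol{x},\boldsymbol{y}\in\mathbb{R}^n$ and $\tau\in[0,1]$, and concave if $-\phi$ is convex. Its extension to $\mathbf{H}^n$ is $\phi(A)=\phi(\boldsymbol{\lambda}(A))$, $A\in\mathbf{H}^n$. *)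

theory Defs
  imports "HOL-Analysis.Analysis" "HOL-Computational_Algebra.Computational_Algebra"
begin

definition hermitian_mat :: "complex ^ 'n ^ 'n \<Rightarrow> bool" where
  "hermitian_mat A \<longleftrightarrow> (\<forall>i j. A $ i $ j = cnj (A $ j $ i))"

definition charpoly :: "complex ^ 'n ^ 'n \<Rightarrow> complex poly" where
  "charpoly A = det (mat [:0, 1:] - (\<chi> i j. [:A $ i $ j:]))"

(* The eigenvalues counted with (algebraic = geometric) multiplicity.  The eigenvalues of a
   Hermitian matrix are real, so Re only changes the type. *)
definition eigenvalues :: "complex ^ 'n ^ 'n \<Rightarrow> real multiset" where
  "eigenvalues A = image_mset Re (proots (charpoly A))"

definition eigval_up :: "nat \<Rightarrow> complex ^ 'n ^ 'n \<Rightarrow> real" where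
  "eigval_up i A = sorted_list_of_multiset (eigenvalues A) ! (i - 1)"

definition eigval_down :: "nat \<Rightarrow> complex ^ 'n ^ 'n \<Rightarrow> real" where
  "eigval_down i A = rev (sorted_list_of_multiset (eigenvalues A)) ! (i - 1)"

(* The index type carries no order, so the arrangement of the entries is arbitrary; this is
   immaterial under symmetric forms.  Such a vector exists by eigval_vec_entries below. *)
definition eigval_vec :: "complex ^ 'n ^ 'n \<Rightarrow> real ^ 'n" where
  "eigval_vec A = (SOME v. image_mset (($) v) (mset_set UNIV) = eigenvalues A)"

definition symmetric_form :: "(real ^ 'n \<Rightarrow> real) \<Rightarrow> bool" where
  "symmetric_form \<phi> \<longleftrightarrow> (\<forall>p x. p permutes UNIV \<longrightarrow> \<phi> (\<chi> i. x $ p i) = \<phi> x)"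

definition spectral_ext :: "(real ^ 'n \<Rightarrow> real) \<Rightarrow> complex ^ 'n ^ 'n \<Rightarrow> real" where
  "spectral_ext \<phi> A = \<phi> (eigval_vec A)"

lemma degree_charpoly: "degree (charpoly (A :: complex ^ 'n ^ 'n)) = CARD('n)"
proof -
  define M where "M = (mat [:0, 1:] - (\<chi> i j. [:A $ i $ j:]) :: complex poly ^ 'n ^ 'n)"
  have Mii: "M $ i $ i = [:- A $ i $ i, 1:]" for i
    by (simp add: M_def mat_def)
  have Mij: "M $ i $ j = [:- A $ i $ j:]" if "i \<noteq> j" for i j
    using that by (simp add: M_def mat_def)
  let ?P = "{p. p permutes (UNIV :: 'n set)}"
  define t where "t p = of_int (sign p) * (\<Prod>i\<in>UNIV. M $ i $ p i)" for p
  have det: "charpoly A = t id + (\<Sum>p\<in>?P - {id}. t p)"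
    unfolding charpoly_def det_def t_def M_def[symmetric]
    by (subst sum.remove[of _ id]) (auto simp: finite_permutations permutes_id)
  have d_id: "degree (t id) = CARD('n)"
    by (simp add: t_def Mii degree_prod_eq_sum_degree sign_id)
  have d_p: "degree (t p) < CARD('n)" if "p \<in> ?P - {id}" for p
  proof -
    from that obtain k where k: "p k \<noteq> k" by (auto simp: fun_eq_iff)
    have "degree (t p) \<le> degree (of_int (sign p) :: complex poly) +
        degree (\<Prod>i\<in>UNIV. M $ i $ p i)"
      unfolding t_def by (rule degree_mult_le)
    also have "\<dots> \<le> (\<Sum>i\<in>UNIV. degree (M $ i $ p i))"
      using degree_prod_sum_le[of UNIV "\<lambda>i. M $ i $ p i"] by (simp add: o_def)
    also have "\<dots> = (\<Sum>i\<in>UNIV - {k}. degree (M $ i $ p i))"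
      using k by (subst sum.remove[of _ k]) (auto simp: Mij)
    also have "\<dots> \<le> (\<Sum>i\<in>UNIV - {k}. 1)"
    proof (rule sum_mono)
      fix i show "degree (M $ i $ p i) \<le> 1"
        by (cases "p i = i") (auto simp: Mii Mij)
    qed
    also have "\<dots> < CARD('n)" by (simp add: card_Diff_singleton)
    finally show ?thesis .
  qed
  have "degree (\<Sum>p\<in>?P - {id}. t p) < CARD('n)"
    by (rule degree_sum_less) (use d_p in auto)
  then show ?thesis
    using d_id by (simp add: det degree_add_eq_left)
qed

lemma size_eigenvalues: "size (eigenvalues (A :: complex ^ 'n ^ 'n)) = CARD('n)"
  by (simp add: eigenvalues_def size_proots_complex degree_charpoly)

lemma eigval_vec_entries:
  "image_mset (($) (eigval_vec A)) (mset_set UNIV) = eigenvalues (A :: complex ^ 'n ^ 'n)"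
proof -
  obtain xs where xs: "mset xs = eigenvalues A"
    using ex_mset by blast
  then have len: "length xs = CARD('n)"
    by (metis size_eigenvalues size_mset)
  obtain h where h: "bij_betw h (UNIV :: 'n set) {0..<CARD('n)}"
    using ex_bij_betw_finite_nat[of "UNIV :: 'n set"] by auto
  have "image_mset (\<lambda>i. xs ! h i) (mset_set (UNIV :: 'n set)) =
      image_mset ((!) xs) (image_mset h (mset_set UNIV))"
    by (simp add: image_mset.compositionality o_def)
  also have "image_mset h (mset_set UNIV) = mset_set {0..<length xs}"
    using h by (simp add: image_mset_mset_set bij_betw_def len)
  also have "image_mset ((!) xs) \<dots> = mset xs"
    by (metis map_nth mset_map mset_upt)
  also have "(\<lambda>i. xs ! h i) = ($) (\<chi> i. xs ! h i)"
    by (simp add: fun_eq_iff)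
  finally have "image_mset (($) (\<chi> i. xs ! h i)) (mset_set (UNIV :: 'n set)) = eigenvalues A"
    by (simp only: xs)
  then show ?thesis
    unfolding eigval_vec_def by (rule someI)
qed

end

theory Submission
  imports Defs
begin

text \<open>Put \<open>v X = eigval_vec (F X)\<close>. The convex half of the theorem compares the composition of \<open>v\<close>
  with arbitrary monotone convex symmetric forms to its composition with the particular forms \<open>top_sum k\<close>, the sum of the \<open>k\<close> largest entries.

  One direction holds because \<open>top_sum k\<close> is itself a monotone convex symmetric form, being a maximum
  of the linear forms \<open>\<lambda>x. \<Sum>i\<in>S. x $ i\<close> over the \<open>k\<close>-element sets \<open>S\<close>.

  For the other direction, write \<open>z\<close> for the value of \<open>v\<close> at a convex combination of \<open>X\<close> and \<open>Y\<close>.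
  Rearrange the entries of \<open>v Y\<close> so that they are ordered in the same way as those of \<open>v X\<close>, and let \<open>w\<close>
  be the corresponding convex combination of \<open>v X\<close> and the rearranged \<open>v Y\<close>. On similarly ordered
  vectors \<open>top_sum k\<close> is affine, so convexity of \<open>top_sum k \<circ> v\<close> says that \<open>top_sum k z \<le> top_sum k w\<close>
  for all \<open>k\<close>: \<open>z\<close> is weakly majorized by \<open>w\<close>. It remains to see that a monotone convex symmetric form
  respects weak majorization. This follows from \<open>weak_majorization_hull\<close>: \<open>z\<close> lies
  below a convex combination \<open>u\<close> of rearrangements of \<open>w\<close>, whence \<open>\<phi> z \<le> \<phi> u \<le> \<phi> w\<close>. Such
  a \<open>u\<close> exists because otherwise a hyperplane would separate \<open>z\<close> from all vectors below the
  hull; its normal would be nonnegative, and summation by parts (\<open>abel_sum_mono\<close>) rules this out.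

  The concave half is the convex half for \<open>-v\<close>, under the correspondence \<open>\<phi> \<mapsto> (\<lambda>x. - \<phi> (- x))\<close>.\<close>

section \<open>Sums of the largest entries\<close>

text \<open>The maximum over subsets, rather than a sum over a sorted list, makes convexity, monotonicity and
  symmetry immediate.\<close>
definition top_sum :: "nat \<Rightarrow> real ^ 'n \<Rightarrow> real" where
  "top_sum k v = Max ((\<lambda>S. \<Sum>i\<in>S. v $ i) ` {S. card S = k})"

definition decreasing_enum :: "(nat \<Rightarrow> 'n::finite) \<Rightarrow> real ^ 'n \<Rightarrow> bool" where
  "decreasing_enum g v \<longleftrightarrow> bij_betw g {..<CARD('n)} UNIV \<and>
     (\<forall>i j. i \<le> j \<longrightarrow> j < CARD('n) \<longrightarrow> v $ g j \<le> v $ g i)"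

lemma decreasing_enum_exists: "\<exists>g. decreasing_enum g (v :: real ^ 'n)"
proof -
  obtain xs :: "'n list" where xs: "set xs = UNIV" "distinct xs"
    using finite_distinct_list[of "UNIV :: 'n set"] by auto
  define ws where "ws = sort_key (\<lambda>i. - v $ i) xs"
  have ws: "set ws = UNIV" "distinct ws" "sorted (map (\<lambda>i. - v $ i) ws)"
    using xs by (auto simp: ws_def)
  have len: "length ws = CARD('n)"
    using distinct_card[OF ws(2)] ws(1) by simp
  have "bij_betw ((!) ws) {..<CARD('n)} UNIV"
    using bij_betw_nth[OF ws(2), of "{..<CARD('n)}" UNIV] ws(1) len by simp
  moreover have "v $ (ws ! j) \<le> v $ (ws ! i)" if "i \<le> j" "j < CARD('n)" for i j
    using sorted_nth_mono[OF ws(3) that(1)] that len by simp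
  ultimately show ?thesis
    unfolding decreasing_enum_def by blast
qed

lemma sum_le_sum_initial:
  fixes b :: "nat \<Rightarrow> real"
  assumes b: "\<And>i j. i \<le> j \<Longrightarrow> j < n \<Longrightarrow> b j \<le> b i"
    and S: "S \<subseteq> {..<n}" "card S = k"
  shows "(\<Sum>j\<in>S. b j) \<le> (\<Sum>j<k. b j)"
proof (cases k)
  case 0
  then show ?thesis
    using S finite_subset[OF S(1)] by simp
next
  case (Suc m)
  have fin: "finite S"
    using S(1) finite_subset by blast
  have kn: "k \<le> n"
    using card_mono[OF _ S(1)] S(2) by simp
  (* After subtracting the threshold b m, the terms are nonnegative before index k and
     nonpositive from it on; both sums have k terms, so the subtraction changes them equally. *)
  have "(\<Sum>j\<in>S. b j - b m) \<le> (\<Sum>j\<in>S \<inter> {..<k}. b j - b m)"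
  proof -
    have "(\<Sum>j\<in>S - {..<k}. b j - b m) \<le> 0"
      by (rule sum_nonpos) (use b S(1) Suc in auto)
    then show ?thesis
      using sum.Int_Diff[OF fin, of "\<lambda>j. b j - b m" "{..<k}"] by simp
  qed
  also have "\<dots> \<le> (\<Sum>j<k. b j - b m)"
    by (rule sum_mono2) (use b kn Suc in auto)
  finally show ?thesis
    using S(2) by (simp add: sum_subtractf)
qed

lemma card_subset_sum_le_top_sum:
  "card S = k \<Longrightarrow> (\<Sum>i\<in>S. (v :: real ^ 'n) $ i) \<le> top_sum k v"
  unfolding top_sum_def by (rule Max_ge) auto

lemma top_sum_attained:
  assumes "k \<le> CARD('n)"
  obtains S where "card S = k" "top_sum k (v :: real ^ 'n) = (\<Sum>i\<in>S. v $ i)"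
proof -
  obtain S :: "'n set" where "card S = k"
    using obtain_subset_with_card_n[OF assms] by auto
  then have "top_sum k v \<in> (\<lambda>S. \<Sum>i\<in>S. v $ i) ` {S. card S = k}"
    unfolding top_sum_def by (intro Max_in) auto
  then show ?thesis
    using that by auto
qed

lemma top_sum_decreasing_enum:
  assumes g: "decreasing_enum g (v :: real ^ 'n)" and k: "k \<le> CARD('n)"
  shows "top_sum k v = (\<Sum>j<k. v $ g j)"
proof (rule antisym)
  have bij: "bij_betw g {..<CARD('n)} UNIV"
    and dec: "\<And>i j. i \<le> j \<Longrightarrow> j < CARD('n) \<Longrightarrow> v $ g j \<le> v $ g i"
    using g by (auto simp: decreasing_enum_def)
  obtain S where S: "card S = k" "top_sum k v = (\<Sum>i\<in>S. v $ i)"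
    using top_sum_attained[OF k] .
  define R where "R = {j. j < CARD('n) \<and> g j \<in> S}"
  have R: "bij_betw g R S"
    using bij by (auto simp: R_def bij_betw_def inj_on_def image_iff)
  have "(\<Sum>i\<in>S. v $ i) = (\<Sum>j\<in>R. v $ g j)"
    using sum.reindex_bij_betw[OF R, of "\<lambda>i. v $ i"] by simp
  also have "\<dots> \<le> (\<Sum>j<k. v $ g j)"
    by (rule sum_le_sum_initial[of "CARD('n)", OF dec])
       (use bij_betw_same_card[OF R] S(1) in \<open>auto simp: R_def\<close>)
  finally show "top_sum k v \<le> (\<Sum>j<k. v $ g j)"
    using S(2) by simp
  have inj: "inj_on g {..<k}"
    using bij k by (auto simp: bij_betw_def intro: inj_on_subset)
  then have "(\<Sum>j<k. v $ g j) = (\<Sum>i\<in>g ` {..<k}. v $ i)"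
    by (simp add: sum.reindex)
  also have "\<dots> \<le> top_sum k v"
    by (rule card_subset_sum_le_top_sum) (simp add: card_image inj)
  finally show "(\<Sum>j<k. v $ g j) \<le> top_sum k v" .
qed

lemma mono_top_sum:
  assumes "k \<le> CARD('n)"
  shows "mono (top_sum k :: real ^ 'n \<Rightarrow> real)"
proof (rule monoI)
  fix x y :: "real ^ 'n" assume le: "x \<le> y"
  obtain S where S: "card S = k" "top_sum k x = (\<Sum>i\<in>S. x $ i)"
    using top_sum_attained[OF assms] .
  have "(\<Sum>i\<in>S. x $ i) \<le> (\<Sum>i\<in>S. y $ i)"
    using le by (intro sum_mono) (simp add: less_eq_vec_def)
  then show "top_sum k x \<le> top_sum k y"
    using S card_subset_sum_le_top_sum[OF S(1), of y] by simp
qed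

lemma convex_top_sum:
  assumes "k \<le> CARD('n)"
  shows "convex_on UNIV (top_sum k :: real ^ 'n \<Rightarrow> real)"
proof (rule convex_onI)
  fix t :: real and x y :: "real ^ 'n" assume t: "0 < t" "t < 1"
  obtain S where S: "card S = k"
    "top_sum k ((1 - t) *\<^sub>R x + t *\<^sub>R y) = (\<Sum>i\<in>S. ((1 - t) *\<^sub>R x + t *\<^sub>R y) $ i)"
    using top_sum_attained[OF assms] .
  have "(\<Sum>i\<in>S. ((1 - t) *\<^sub>R x + t *\<^sub>R y) $ i) = (1 - t) * (\<Sum>i\<in>S. x $ i) + t * (\<Sum>i\<in>S. y $ i)"
    by (simp add: sum.distrib sum_distrib_left)
  also have "\<dots> \<le> (1 - t) * top_sum k x + t * top_sum k y"
    using t by (intro add_mono mult_left_mono card_subset_sum_le_top_sum S(1)) auto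
  finally show "top_sum k ((1 - t) *\<^sub>R x + t *\<^sub>R y) \<le> (1 - t) * top_sum k x + t * top_sum k y"
    using S(2) by simp
qed simp

text \<open>A permutation of the indices merely permutes the \<open>k\<close>-element sets over which the maximum is
  taken.\<close>
lemma symmetric_top_sum:
  assumes "k \<le> CARD('n)"
  shows "symmetric_form (top_sum k :: real ^ 'n \<Rightarrow> real)"
  unfolding symmetric_form_def
proof (intro allI impI)
  fix p :: "'n \<Rightarrow> 'n" and x :: "real ^ 'n" assume p: "p permutes UNIV"
  have le: "top_sum k (\<chi> i. y $ q i) \<le> top_sum k y" if q: "q permutes UNIV"
    for q and y :: "real ^ 'n"
  proof -
    have inj: "inj_on q S" for S
      using permutes_inj_on[OF q] .
    obtain S where S: "card S = k" "top_sum k (\<chi> i. y $ q i) = (\<Sum>i\<in>S. (\<chi> i. y $ q i) $ i)"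
      using top_sum_attained[OF assms] .
    have "(\<Sum>i\<in>S. (\<chi> i. y $ q i) $ i) = (\<Sum>i\<in>q ` S. y $ i)"
      by (simp add: sum.reindex inj)
    also have "\<dots> \<le> top_sum k y"
      by (rule card_subset_sum_le_top_sum) (simp add: card_image inj S(1))
    finally show ?thesis
      using S(2) by simp
  qed
  have "(\<chi> i. (\<chi> i. x $ p i) $ inv p i) = x"
    using permutes_inverses[OF p] by (simp add: vec_eq_iff)
  then show "top_sum k (\<chi> i. x $ p i) = top_sum k x"
    using le[OF p, of x] le[OF permutes_inv[OF p], of "\<chi> i. x $ p i"] by simp
qed

section \<open>Weak majorization\<close>

lemma decreasing_enum_transfer:
  assumes "bij_betw e {..<CARD('n)} UNIV" "bij_betw g {..<CARD('n)} (UNIV :: 'n::finite set)"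
  obtains p where "p permutes UNIV" "\<And>j. j < CARD('n) \<Longrightarrow> p (e j) = g j"
proof
  let ?p = "g \<circ> inv_into {..<CARD('n)} e"
  have "bij_betw ?p UNIV UNIV"
    by (rule bij_betw_trans[OF bij_betw_inv_into[OF assms(1)] assms(2)])
  then show "?p permutes UNIV"
    by (rule bij_imp_permutes) simp
  show "?p (e j) = g j" if "j < CARD('n)" for j
    using that assms(1) by (simp add: bij_betw_def inv_into_f_f)
qed

text \<open>Summation by parts writes both sides as combinations of partial sums with the nonnegative
  weights \<open>a i - a (i + 1)\<close> and \<open>a (n - 1)\<close>.\<close>
lemma abel_sum_mono:
  fixes a z w :: "nat \<Rightarrow> real"
  assumes anti: "\<And>i j. i \<le> j \<Longrightarrow> j < n \<Longrightarrow> a j \<le> a i"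
    and nonneg: "\<And>i. i < n \<Longrightarrow> 0 \<le> a i"
    and partial: "\<And>k. k \<le> n \<Longrightarrow> (\<Sum>j<k. z j) \<le> (\<Sum>j<k. w j)"
  shows "(\<Sum>j<n. a j * z j) \<le> (\<Sum>j<n. a j * w j)"
proof -
  define D where "D k = (\<Sum>j<k. w j) - (\<Sum>j<k. z j)" for k
  have D: "0 \<le> D k" if "k \<le> n" for k
    using partial[OF that] by (simp add: D_def)
  (* The boundary term of the summation by parts is a lower bound, since the terms
     (a i - a (i + 1)) * D (i + 1) that it leaves out are nonnegative. *)
  have step: "a m * D (Suc m) \<le> (\<Sum>j<Suc m. a j * (w j - z j))" if "m < n" for m
    using that
  proof (induction m)
    case 0
    then show ?case by (simp add: D_def)
  next
    case (Suc m)
    have "a (Suc m) * D (Suc m) \<le> a m * D (Suc m)"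
      using Suc.prems by (intro mult_right_mono anti D) auto
    moreover have "D (Suc (Suc m)) = D (Suc m) + (w (Suc m) - z (Suc m))"
      by (simp add: D_def)
    ultimately show ?case
      using Suc by (simp add: distrib_left)
  qed
  have "0 \<le> (\<Sum>j<n. a j * (w j - z j))"
  proof (cases n)
    case (Suc m)
    then show ?thesis
      using step[of m] mult_nonneg_nonneg[OF nonneg[of m] D[of n]] by simp
  qed simp
  then show ?thesis
    by (simp add: right_diff_distrib sum_subtractf)
qed

text \<open>The rearrangement of \<open>w\<close> that is ordered like \<open>a\<close> serves as \<open>p\<close>: in the order given by \<open>a\<close>, the
  partial sums of \<open>z\<close> are at most \<open>top_sum k z \<le> top_sum k w\<close>, which are the partial sums of the
  rearranged \<open>w\<close>.\<close>
lemma weak_majorization_inner: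
  fixes z w a :: "real ^ 'n"
  assumes maj: "\<And>k. k \<le> CARD('n) \<Longrightarrow> top_sum k z \<le> top_sum k w"
    and a: "\<And>i. 0 \<le> a $ i"
  shows "\<exists>p. p permutes UNIV \<and> a \<bullet> z \<le> a \<bullet> (\<chi> i. w $ p i)"
proof -
  obtain e where e: "decreasing_enum e a"
    using decreasing_enum_exists by blast
  obtain g where g: "decreasing_enum g w"
    using decreasing_enum_exists by blast
  have be: "bij_betw e {..<CARD('n)} UNIV" and bg: "bij_betw g {..<CARD('n)} UNIV"
    using e g by (auto simp: decreasing_enum_def)
  obtain p where p: "p permutes UNIV" "\<And>j. j < CARD('n) \<Longrightarrow> p (e j) = g j"
    using decreasing_enum_transfer[OF be bg] by blast
  have partial: "(\<Sum>j<k. z $ e j) \<le> (\<Sum>j<k. w $ g j)" if "k \<le> CARD('n)" for k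
  proof -
    have inj: "inj_on e {..<k}"
      using be that by (auto simp: bij_betw_def intro: inj_on_subset)
    then have "(\<Sum>j<k. z $ e j) = (\<Sum>i\<in>e ` {..<k}. z $ i)"
      by (simp add: sum.reindex)
    also have "\<dots> \<le> top_sum k z"
      by (rule card_subset_sum_le_top_sum) (simp add: card_image inj)
    also have "\<dots> \<le> top_sum k w"
      by (rule maj[OF that])
    finally show ?thesis
      using top_sum_decreasing_enum[OF g that] by simp
  qed
  have inner: "a \<bullet> x = (\<Sum>j<CARD('n). a $ e j * x $ e j)" for x
    using sum.reindex_bij_betw[OF be, of "\<lambda>i. a $ i * x $ i"] by (simp add: inner_vec_def)
  have "(\<Sum>j<CARD('n). a $ e j * z $ e j) \<le> (\<Sum>j<CARD('n). a $ e j * w $ g j)"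
    by (rule abel_sum_mono) (use e a partial in \<open>auto simp: decreasing_enum_def\<close>)
  then show ?thesis
    using p by (intro exI[of _ p]) (simp add: inner)
qed

text \<open>The vectors below the hull form a closed convex set, namely the hull plus the nonpositive
  orthant. Since the set is unbounded in the negative directions, the normal of
  a hyperplane separating \<open>z\<close> from it is nonnegative, contradicting \<open>weak_majorization_inner\<close>.\<close>
lemma weak_majorization_hull:
  fixes z w :: "real ^ 'n"
  assumes maj: "\<And>k. k \<le> CARD('n) \<Longrightarrow> top_sum k z \<le> top_sum k w"
  shows "\<exists>u \<in> convex hull ((\<lambda>p. \<chi> i. w $ p i) ` {p. p permutes UNIV}). z \<le> u"
proof (rule ccontr)
  define H where "H = convex hull ((\<lambda>p. \<chi> i. w $ p i) ` {p. p permutes (UNIV :: 'n set)})"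
  define N where "N = {x :: real ^ 'n. \<forall>i. x $ i \<le> 0}"
  define C where "C = (\<Union>u\<in>H. \<Union>x\<in>N. {u + x})"
  assume "\<not> ?thesis"
  then have no: "\<not> z \<le> u" if "u \<in> H" for u
    using that by (auto simp: H_def)
  have N_Int: "N = (\<Inter>i. {x. x $ i \<le> 0})"
    by (auto simp: N_def)
  have "compact H"
    unfolding H_def by (intro finite_imp_compact_convex_hull finite_imageI finite_permutations) simp
  moreover have "closed N"
    unfolding N_Int by (intro closed_INT ballI closed_halfspace_component_le_cart)
  ultimately have "closed C"
    unfolding C_def by (rule compact_closed_sums)
  moreover have "convex N"
    unfolding N_def convex_def
    by (auto intro!: add_nonpos_nonpos mult_nonneg_nonpos)
  then have "convex C"
    unfolding C_def by (intro convex_sums) (simp_all add: H_def)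
  moreover have "z \<notin> C"
  proof
    assume "z \<in> C"
    then obtain u x where "u \<in> H" "x \<in> N" "z = u + x"
      by (auto simp: C_def)
    then have "z \<le> u"
      by (auto simp: N_def less_eq_vec_def)
    with no \<open>u \<in> H\<close> show False by blast
  qed
  ultimately obtain a b where ab: "a \<bullet> z < b" "\<And>x. x \<in> C \<Longrightarrow> a \<bullet> x > b"
    using separating_hyperplane_closed_point[of C z] by blast
  have perm_H: "(\<chi> i. w $ p i) \<in> H" if "p permutes UNIV" for p
    using that by (auto simp: H_def intro: hull_inc)
  have H_C: "u \<in> C" if "u \<in> H" for u
    using that unfolding C_def N_def by (intro UN_I[of u] UN_I[of 0]) auto
  have wH: "w \<in> H"
    using perm_H[OF permutes_id] by simp
  (* C lies on the side where the inner product with a is large, so the outward normal,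
     which has to be nonnegative, is - a. *)
  have a: "a $ i \<le> 0" for i
  proof (rule ccontr)
    assume "\<not> a $ i \<le> 0"
    then have pos: "a $ i > 0" by simp
    (* Moving from w far enough along the negative i-th axis leaves the half-space. *)
    define t where "t = (a \<bullet> w - b) / a $ i"
    have "t > 0"
      using pos ab(2)[OF H_C[OF wH]] by (simp add: t_def)
    then have "axis i (- t) \<in> N"
      by (simp add: N_def axis_def)
    then have "w + axis i (- t) \<in> C"
      using wH by (auto simp: C_def)
    from ab(2)[OF this] show False
      using pos by (simp add: inner_add_right inner_axis t_def)
  qed
  obtain p where p: "p permutes UNIV" "(- a) \<bullet> z \<le> (- a) \<bullet> (\<chi> i. w $ p i)"
    using weak_majorization_inner[OF maj, of "- a"] a by auto
  then show False
    using ab(1) ab(2)[OF H_C[OF perm_H[OF p(1)]]] by simp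
qed

lemma symmetric_form_weak_majorization:
  fixes z w :: "real ^ 'n"
  assumes \<phi>: "mono \<phi>" "convex_on UNIV \<phi>" "symmetric_form \<phi>"
    and maj: "\<And>k. k \<le> CARD('n) \<Longrightarrow> top_sum k z \<le> top_sum k w"
  shows "\<phi> z \<le> \<phi> w"
proof -
  let ?P = "(\<lambda>p. \<chi> i. w $ p i) ` {p. p permutes (UNIV :: 'n set)}"
  obtain u where u: "u \<in> convex hull ?P" "z \<le> u"
    using weak_majorization_hull[OF maj] by blast
  have "\<forall>x\<in>convex hull ?P. \<phi> x \<le> \<phi> w"
  proof (rule convex_on_convex_hull_bound)
    show "convex_on (convex hull ?P) \<phi>"
      by (rule convex_on_subset[OF \<phi>(2)]) auto
    show "\<forall>x\<in>?P. \<phi> x \<le> \<phi> w"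
      using \<phi>(3) by (auto simp: symmetric_form_def)
  qed
  then show ?thesis
    using u \<phi>(1) by (meson monoD order_trans)
qed

section \<open>Convexity of symmetric forms along a vector-valued map\<close>

text \<open>Comonotone rearrangement turns the convexity of the \<open>top_sum k \<circ> v\<close>, which is an inequality between
  three values for each \<open>k\<close>, into the weak majorization of one vector by another.\<close>
lemma convex_on_symmetric_form_comp:
  fixes v :: "'a::real_vector \<Rightarrow> real ^ 'n"
  assumes \<Omega>: "convex \<Omega>"
    and tops: "\<And>k. 1 \<le> k \<Longrightarrow> k \<le> CARD('n) \<Longrightarrow> convex_on \<Omega> (\<lambda>X. top_sum k (v X))"
    and \<phi>: "mono \<phi>" "convex_on UNIV \<phi>" "symmetric_form \<phi>"
  shows "convex_on \<Omega> (\<lambda>X. \<phi> (v X))"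
proof (rule convex_onI[OF _ \<Omega>])
  fix t :: real and X Y assume t: "0 < t" "t < 1" and X: "X \<in> \<Omega>" and Y: "Y \<in> \<Omega>"
  obtain g where g: "decreasing_enum g (v X)"
    using decreasing_enum_exists by blast
  obtain h where h: "decreasing_enum h (v Y)"
    using decreasing_enum_exists by blast
  have bg: "bij_betw g {..<CARD('n)} UNIV" and bh: "bij_betw h {..<CARD('n)} UNIV"
    using g h by (auto simp: decreasing_enum_def)
  obtain p where p: "p permutes UNIV" "\<And>j. j < CARD('n) \<Longrightarrow> p (g j) = h j"
    using decreasing_enum_transfer[OF bg bh] by blast
  (* y is v Y rearranged so that g enumerates its entries in decreasing order as well. *)
  define y where "y = (\<chi> i. v Y $ p i)"
  define w where "w = (1 - t) *\<^sub>R v X + t *\<^sub>R y"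
  have g_w: "decreasing_enum g w"
    using g h p t by (auto simp: decreasing_enum_def w_def y_def intro!: add_mono mult_left_mono)
  have maj: "top_sum k (v ((1 - t) *\<^sub>R X + t *\<^sub>R Y)) \<le> top_sum k w" if k: "k \<le> CARD('n)" for k
  proof (cases "k = 0")
    case True
    then show ?thesis
      using top_sum_decreasing_enum[OF g_w k] decreasing_enum_exists[of "v ((1 - t) *\<^sub>R X + t *\<^sub>R Y)"]
      by (auto dest: top_sum_decreasing_enum[where k = 0])
  next
    case False
    then have "top_sum k (v ((1 - t) *\<^sub>R X + t *\<^sub>R Y)) \<le> (1 - t) * top_sum k (v X) + t * top_sum k (v Y)"
      using convex_onD[OF tops[of k], of t X Y] k t X Y by simp
    also have "\<dots> = (\<Sum>j<k. (1 - t) * v X $ g j + t * v Y $ h j)"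
      using top_sum_decreasing_enum[OF g k] top_sum_decreasing_enum[OF h k]
      by (simp add: sum.distrib sum_distrib_left)
    also have "\<dots> = (\<Sum>j<k. w $ g j)"
      using k p(2) by (intro sum.cong) (auto simp: w_def y_def)
    also have "\<dots> = top_sum k w"
      using top_sum_decreasing_enum[OF g_w k] by simp
    finally show ?thesis .
  qed
  have "\<phi> (v ((1 - t) *\<^sub>R X + t *\<^sub>R Y)) \<le> \<phi> w"
    by (rule symmetric_form_weak_majorization[OF \<phi> maj])
  also have "\<dots> \<le> (1 - t) * \<phi> (v X) + t * \<phi> y"
    unfolding w_def using convex_onD[OF \<phi>(2), of t "v X" y] t by simp
  also have "\<phi> y = \<phi> (v Y)"
    using \<phi>(3) p(1) by (simp add: symmetric_form_def y_def)
  finally show "\<phi> (v ((1 - t) *\<^sub>R X + t *\<^sub>R Y)) \<le> (1 - t) * \<phi> (v X) + t * \<phi> (v Y)" .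
qed

lemma convex_symmetric_forms_iff_top_sums:
  fixes v :: "'a::real_vector \<Rightarrow> real ^ 'n"
  assumes "convex \<Omega>"
  shows "(\<forall>\<phi>. mono \<phi> \<and> convex_on UNIV \<phi> \<and> symmetric_form \<phi> \<longrightarrow> convex_on \<Omega> (\<lambda>X. \<phi> (v X))) \<longleftrightarrow>
         (\<forall>k. 1 \<le> k \<and> k \<le> CARD('n) \<longrightarrow> convex_on \<Omega> (\<lambda>X. top_sum k (v X)))"
  using convex_on_symmetric_form_comp[OF assms] mono_top_sum convex_top_sum symmetric_top_sum
  by blast

definition reflect_form :: "(real ^ 'n \<Rightarrow> real) \<Rightarrow> real ^ 'n \<Rightarrow> real" where
  "reflect_form \<phi> x = - \<phi> (- x)"

lemma convex_on_reflect_form: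
  assumes "concave_on UNIV \<phi>"
  shows "convex_on UNIV (reflect_form \<phi>)"
proof (rule convex_onI)
  fix t :: real and x y :: "real ^ 'a" assume "0 < t" "t < 1"
  then show "reflect_form \<phi> ((1 - t) *\<^sub>R x + t *\<^sub>R y) \<le> (1 - t) * reflect_form \<phi> x + t * reflect_form \<phi> y"
    using convex_onD[OF assms[unfolded concave_on_def], of t "- x" "- y"]
    by (simp add: reflect_form_def)
qed simp

lemma concave_on_reflect_form:
  assumes "convex_on UNIV \<phi>"
  shows "concave_on UNIV (reflect_form \<phi>)"
  unfolding concave_on_def
proof (rule convex_onI)
  fix t :: real and x y :: "real ^ 'a" assume "0 < t" "t < 1"
  then show "- reflect_form \<phi> ((1 - t) *\<^sub>R x + t *\<^sub>R y) \<le> (1 - t) * - reflect_form \<phi> x + t * - reflect_form \<phi> y"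
    using convex_onD[OF assms, of t "- x" "- y"]
    by (simp add: reflect_form_def)
qed simp

lemma mono_reflect_form: "mono \<phi> \<Longrightarrow> mono (reflect_form \<phi>)"
  by (auto simp: reflect_form_def less_eq_vec_def intro!: monoI elim!: monoD)

lemma symmetric_reflect_form:
  assumes "symmetric_form \<phi>"
  shows "symmetric_form (reflect_form \<phi>)"
proof -
  have "- (\<chi> i. x $ p i) = (\<chi> i. (- x) $ p i)" for x :: "real ^ 'a" and p
    by (simp add: vec_eq_iff)
  then show ?thesis
    using assms unfolding symmetric_form_def reflect_form_def by metis
qed

lemma concave_symmetric_forms_iff_top_sums:
  fixes v :: "'a::real_vector \<Rightarrow> real ^ 'n"
  assumes "convex \<Omega>"
  shows "(\<forall>\<phi>. mono \<phi> \<and> concave_on UNIV \<phi> \<and> symmetric_form \<phi> \<longrightarrow> concave_on \<Omega> (\<lambda>X. \<phi> (v X))) \<longleftrightarrow>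
         (\<forall>k. 1 \<le> k \<and> k \<le> CARD('n) \<longrightarrow> concave_on \<Omega> (\<lambda>X. - top_sum k (- v X)))"
proof -
  have "(\<forall>\<phi>. mono \<phi> \<and> concave_on UNIV \<phi> \<and> symmetric_form \<phi> \<longrightarrow> concave_on \<Omega> (\<lambda>X. \<phi> (v X))) \<longleftrightarrow>
        (\<forall>\<psi>. mono \<psi> \<and> convex_on UNIV \<psi> \<and> symmetric_form \<psi> \<longrightarrow> convex_on \<Omega> (\<lambda>X. \<psi> (- v X)))"
    (is "?L \<longleftrightarrow> ?R")
  proof
    assume L: ?L
    show ?R
    proof (intro allI impI)
      fix \<psi> :: "real ^ 'n \<Rightarrow> real" assume "mono \<psi> \<and> convex_on UNIV \<psi> \<and> symmetric_form \<psi>"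
      then have "concave_on \<Omega> (\<lambda>X. reflect_form \<psi> (v X))"
        using L by (simp add: mono_reflect_form concave_on_reflect_form symmetric_reflect_form)
      then show "convex_on \<Omega> (\<lambda>X. \<psi> (- v X))"
        by (simp add: concave_on_def reflect_form_def)
    qed
  next
    assume R: ?R
    show ?L
    proof (intro allI impI)
      fix \<phi> :: "real ^ 'n \<Rightarrow> real" assume "mono \<phi> \<and> concave_on UNIV \<phi> \<and> symmetric_form \<phi>"
      then have "convex_on \<Omega> (\<lambda>X. reflect_form \<phi> (- v X))"
        using R by (simp add: mono_reflect_form convex_on_reflect_form symmetric_reflect_form)
      then show "concave_on \<Omega> (\<lambda>X. \<phi> (v X))"
        by (simp add: concave_on_def reflect_form_def)
    qed
  qed
  then show ?thesis
    using convex_symmetric_forms_iff_top_sums[OF assms, of "\<lambda>X. - v X"]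
    by (simp add: concave_on_def)
qed

section \<open>Ordered eigenvalues\<close>

lemma mset_eigval_vec_enum:
  assumes "bij_betw g {..<CARD('n)} UNIV"
  shows "mset (map (\<lambda>j. eigval_vec A $ g j) [0..<CARD('n)]) = eigenvalues (A :: complex ^ 'n ^ 'n)"
proof -
  have "mset (map (\<lambda>j. eigval_vec A $ g j) [0..<CARD('n)]) =
      image_mset (($) (eigval_vec A)) (image_mset g (mset_set {..<CARD('n)}))"
    by (simp add: image_mset.compositionality o_def lessThan_atLeast0)
  then show ?thesis
    using assms by (simp add: image_mset_mset_set bij_betw_def eigval_vec_entries)
qed

lemma rev_sorted_eigenvalues:
  assumes g: "decreasing_enum g (eigval_vec (A :: complex ^ 'n ^ 'n))"
  shows "rev (sorted_list_of_multiset (eigenvalues A)) = map (\<lambda>j. eigval_vec A $ g j) [0..<CARD('n)]"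
proof -
  let ?xs = "map (\<lambda>j. eigval_vec A $ g j) [0..<CARD('n)]"
  have m: "mset (rev ?xs) = eigenvalues A"
    using g mset_eigval_vec_enum[of g A] by (simp add: decreasing_enum_def)
  have "sorted_wrt (\<ge>) ?xs"
    using g by (auto simp: sorted_wrt_iff_nth_less decreasing_enum_def)
  then have "sorted (rev ?xs)"
    by (simp add: sorted_wrt_rev)
  then have "sorted_list_of_multiset (eigenvalues A) = rev ?xs"
    using m by (metis sort_key_id_if_sorted sorted_list_of_multiset_mset map_ident list.map_id sorted_sort_id)
  then show ?thesis
    by simp
qed

lemma sorted_eigenvalues:
  assumes g: "decreasing_enum g (- eigval_vec (A :: complex ^ 'n ^ 'n))"
  shows "sorted_list_of_multiset (eigenvalues A) = map (\<lambda>j. eigval_vec A $ g j) [0..<CARD('n)]"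
proof -
  let ?xs = "map (\<lambda>j. eigval_vec A $ g j) [0..<CARD('n)]"
  have m: "mset ?xs = eigenvalues A"
    using g mset_eigval_vec_enum[of g A] by (simp add: decreasing_enum_def)
  have "sorted ?xs"
    using g by (auto simp: sorted_wrt_iff_nth_less decreasing_enum_def)
  then show ?thesis
    using m by (metis sorted_list_of_multiset_mset sorted_sort_id)
qed

lemma sum_eigval_down:
  assumes k: "k \<le> CARD('n)"
  shows "(\<Sum>i=1..k. eigval_down i (A :: complex ^ 'n ^ 'n)) = top_sum k (eigval_vec A)"
proof -
  obtain g where g: "decreasing_enum g (eigval_vec A)"
    using decreasing_enum_exists by blast
  have "(\<Sum>i=1..k. eigval_down i A) = (\<Sum>j<k. eigval_down (Suc j) A)"
    by (simp add: sum.atLeast1_atMost_eq)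
  also have "\<dots> = (\<Sum>j<k. eigval_vec A $ g j)"
    using k by (intro sum.cong) (simp_all add: eigval_down_def rev_sorted_eigenvalues[OF g])
  finally show ?thesis
    using top_sum_decreasing_enum[OF g k] by simp
qed

text \<open>The smallest entries of a vector are the negatives of the largest entries of its negative.\<close>
lemma sum_eigval_up:
  assumes k: "k \<le> CARD('n)"
  shows "(\<Sum>i=1..k. eigval_up i (A :: complex ^ 'n ^ 'n)) = - top_sum k (- eigval_vec A)"
proof -
  obtain g where g: "decreasing_enum g (- eigval_vec A)"
    using decreasing_enum_exists by blast
  have "(\<Sum>i=1..k. eigval_up i A) = (\<Sum>j<k. eigval_up (Suc j) A)"
    by (simp add: sum.atLeast1_atMost_eq)
  also have "\<dots> = (\<Sum>j<k. eigval_vec A $ g j)"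
    using k by (intro sum.cong) (simp_all add: eigval_up_def sorted_eigenvalues[OF g])
  finally show ?thesis
    using top_sum_decreasing_enum[OF g k] by (simp add: sum_negf)
qed

section \<open>Convexity and concavity of spectral functions\<close>

theorem theorem2p7:
  fixes \<Omega> :: "'a :: real_vector set"
    and F :: "'a \<Rightarrow> complex ^ 'n ^ 'n"
  assumes "convex \<Omega>"
    and "\<And>X. X \<in> \<Omega> \<Longrightarrow> hermitian_mat (F X)"
  shows "((\<forall>\<phi> :: real ^ 'n \<Rightarrow> real. mono \<phi> \<and> convex_on UNIV \<phi> \<and> symmetric_form \<phi> \<longrightarrow>
             convex_on \<Omega> (\<lambda>X. spectral_ext \<phi> (F X))) \<longleftrightarrow>
          (\<forall>k. 1 \<le> k \<and> k \<le> CARD('n) \<longrightarrow>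
             convex_on \<Omega> (\<lambda>X. \<Sum>i=1..k. eigval_down i (F X)))) \<and>
         ((\<forall>\<phi> :: real ^ 'n \<Rightarrow> real. mono \<phi> \<and> concave_on UNIV \<phi> \<and> symmetric_form \<phi> \<longrightarrow>
             concave_on \<Omega> (\<lambda>X. spectral_ext \<phi> (F X))) \<longleftrightarrow>
          (\<forall>k. 1 \<le> k \<and> k \<le> CARD('n) \<longrightarrow>
             concave_on \<Omega> (\<lambda>X. \<Sum>i=1..k. eigval_up i (F X))))"
  unfolding spectral_ext_def
  using convex_symmetric_forms_iff_top_sums[OF assms(1), of "\<lambda>X. eigval_vec (F X)"]
    concave_symmetric_forms_iff_top_sums[OF assms(1), of "\<lambda>X. eigval_vec (F X)"]
  by (simp add: sum_eigval_down sum_eigval_up del: One_nat_def cong: imp_cong conj_cong)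

end
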